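(* Let $K$ be a field, let $L \subset \mathbb{N}_{\ge 2}$ be a finite nonempty set, and let $f \colon L \to \mathbb{N}$ be a map. Then there are a numerical monoid $H$ and a squarefree element $g \in K[H]$ such that \[ \mathsf L_{K[H]}(g) = L \quad \text{and} \quad |\mathsf Z_{K[H],k}(g)| = f(k) \quad \text{for every } k \in L . \]
   Context: $\mathbb{N}$ denotes the positive integers, $\mathbb{N}_0 = \mathbb{N} \cup \{0\}$, and $\mathbb{N}_{\ge 2}$ the integers $\ge 2$. A numerical monoid is a submonoid of $(\mathbb{N}_0,+)$ whose complement in $\mathbb{N}_0$ is finite. For a field $K$ and a numerical monoid $H$, the semigroup algebra is the subring $K[H] = \{ \sum_{h \in H} a_h X^h : a_h \in K, \text{ almost all } a_h = 0 \}$ of the polynomial ring $K[X]$. Factorizations in the domain $R = K[H]$ refer to the multiplicative monoid $R \setminus \{0\}$ and are considered up to order and associates: let $\mathcal A$ be the set of atoms (irreducible elements) of the reduced monoid $(R\setminus\{0\})/R^\times$, i.e. the classes of irreducible elements of $R$ up to multiplication by units; the factorization monoid $\mathsf Z(R)$ is the free abelian monoid with basis $\mathcal A$, with length $|z|$ of an element $z$ being the number of basis elements in it counted with multiplicity. For nonzero $g \in R$, $\mathsf Z_R(g)$ is the set of $z \in \mathsf Z(R)$ whose product in $(R\setminus\{0\})/R^\times$ equals $gR^\times$; $\mathsf Z_{R,k}(g) = \{ z \in \mathsf Z_R(g) : |z| = k \}$ for $k \in \mathbb{N}$; and $\mathsf L_R(g) = \{ |z| : z \in \mathsf Z_R(g)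 \}$ is the set of lengths of $g$. A nonzero element $g \in R$ is squarefree if there are no nonunit $b \in R$ and $c \in R$ with $g = b^2 c$. *)

theory Defs
  imports
    "HOL-Algebra.Divisibility"
    "HOL-Algebra.Multiplicative_Group"
    "HOL-Library.Multiset"
    "HOL-Computational_Algebra.Polynomial"
begin

text \<open>Here \<^typ>\<open>nat\<close> plays the role of the set of nonnegative integers.\<close>

definition numerical_monoid :: "nat set \<Rightarrow> bool" where
  "numerical_monoid H \<longleftrightarrow> 0 \<in> H \<and> (\<forall>a\<in>H. \<forall>b\<in>H. a + b \<in> H) \<and> finite (- H)"

text \<open>The ring \<open>K[H]\<close>, as a subring of \<open>K[X]\<close>; the field \<open>K\<close> is the type \<^typ>\<open>'a\<close>.\<close>

definition semigroup_algebra :: "nat set \<Rightarrow> 'a::field poly ring" where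
  "semigroup_algebra H =
    \<lparr>carrier = {p. \<forall>n. Polynomial.coeff p n \<noteq> 0 \<longrightarrow> n \<in> H},
     mult = (*), one = 1, zero = 0, add = (+)\<rparr>"

lemma domain_semigroup_algebra:
  fixes H :: "nat set"
  assumes "numerical_monoid H"
  shows "domain (semigroup_algebra H :: 'a::field poly ring)"
proof -
  let ?R = "semigroup_algebra H :: 'a poly ring"
  have mult: "p * q \<in> carrier ?R" if "p \<in> carrier ?R" "q \<in> carrier ?R" for p q
  proof -
    have "n \<in> H" if n: "Polynomial.coeff (p * q) n \<noteq> 0" for n
    proof -
      obtain i where i: "i \<le> n" "Polynomial.coeff p i * Polynomial.coeff q (n - i) \<noteq> 0"
        using n unfolding coeff_mult by (meson atMost_iff sum.neutral)
      then have "i \<in> H" "n - i \<in> H"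
        using \<open>p \<in> carrier ?R\<close> \<open>q \<in> carrier ?R\<close> by (auto simp: semigroup_algebra_def)
      then have "i + (n - i) \<in> H"
        using assms unfolding numerical_monoid_def by blast
      then show ?thesis using i(1) by simp
    qed
    then show ?thesis by (simp add: semigroup_algebra_def)
  qed
  have add: "p + q \<in> carrier ?R" if "p \<in> carrier ?R" "q \<in> carrier ?R" for p q
  proof -
    have "n \<in> H" if "Polynomial.coeff (p + q) n \<noteq> 0" for n
      using that \<open>p \<in> carrier ?R\<close> \<open>q \<in> carrier ?R\<close>
      by (cases "Polynomial.coeff p n = 0") (simp_all add: semigroup_algebra_def)
    then show ?thesis by (simp add: semigroup_algebra_def)
  qed
  have one: "1 \<in> carrier ?R"
    using assms by (auto simp: semigroup_algebra_def numerical_monoid_def coeff_1 split: if_splits)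
  have neg: "\<exists>q \<in> carrier ?R. p + q = 0" if "p \<in> carrier ?R" for p
    using that by (intro bexI[of _ "- p"]) (auto simp: semigroup_algebra_def)
  have ops [simp]: "mult ?R = (*)" "add ?R = (+)" "\<one>\<^bsub>?R\<^esub> = 1" "\<zero>\<^bsub>?R\<^esub> = 0"
    by (simp_all add: semigroup_algebra_def)
  have zero: "0 \<in> carrier ?R"
    by (simp add: semigroup_algebra_def)
  have "abelian_group ?R"
    by (rule abelian_groupI) (simp_all add: add zero neg add.assoc add.commute)
  moreover have "Group.comm_monoid ?R"
    by (rule comm_monoidI) (simp_all add: mult one mult.assoc mult.commute)
  ultimately have "cring ?R"
    by (rule cringI) (simp add: distrib_right)
  then show ?thesis
    by (rule domain.intro) (simp add: domain_axioms_def)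
qed

text \<open>
  The associated reduced monoid: the cosets of the unit group, with the product of sets as
  multiplication. The library defines \<^const>\<open>FactGroup\<close> for arbitrary monoids.
\<close>

definition reduced_monoid :: "('a, 'b) monoid_scheme \<Rightarrow> 'a set monoid" where
  "reduced_monoid G = G Mod Units G"

lemma comm_monoid_reduced_monoid:
  fixes G (structure)
  assumes "comm_monoid G"
  shows "comm_monoid (reduced_monoid G)"
proof -
  interpret comm_monoid G by fact
  have M: "(Units G #> a) <#> (Units G #> b) = Units G #> (a \<otimes> b)"
    if ab: "a \<in> carrier G" "b \<in> carrier G" for a b
  proof (intro equalityI subsetI)
    fix x assume "x \<in> (Units G #> a) <#> (Units G #> b)"
    then obtain u v where uv: "u \<in> Units G" "v \<in> Units G" "x = (u \<otimes> a) \<otimes> (v \<otimes> b)"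
      unfolding set_mult_def r_coset_def by blast
    then have "x = (u \<otimes> v) \<otimes> (a \<otimes> b)"
      using ab Units_closed by (simp add: m_ac)
    then show "x \<in> Units G #> (a \<otimes> b)"
      using uv unfolding r_coset_def by blast
  next
    fix x assume "x \<in> Units G #> (a \<otimes> b)"
    then obtain u where u: "u \<in> Units G" "x = u \<otimes> (a \<otimes> b)"
      unfolding r_coset_def by blast
    then have "x = (u \<otimes> a) \<otimes> (\<one> \<otimes> b)"
      using ab Units_closed by (simp add: m_assoc)
    then show "x \<in> (Units G #> a) <#> (Units G #> b)"
      using u Units_one_closed unfolding set_mult_def r_coset_def by blast
  qed
  have one: "Units G = Units G #> \<one>"
    unfolding r_coset_def using Units_closed by auto
  have U: "Units G <#> (Units G #> a) = Units G #> a" if "a \<in> carrier G" for a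
    using M[of \<one> a] that one by simp
  have "Units G \<in> rcosets Units G"
    using one unfolding RCOSETS_def by blast
  then show ?thesis
    unfolding reduced_monoid_def FactGroup_def
    by (intro comm_monoidI) (auto simp: RCOSETS_def M U m_ac)
qed

definition atoms :: "('a, 'b) monoid_scheme \<Rightarrow> 'a set" where
  "atoms G = {a \<in> carrier G. Divisibility.irreducible G a}"

text \<open>The free abelian monoid on the atoms of the reduced monoid consists of finite multisets.\<close>

definition factorization_monoid :: "('a, 'b) ring_scheme \<Rightarrow> 'a set multiset set" where
  "factorization_monoid R = {z. set_mset z \<subseteq> atoms (reduced_monoid (mult_of R))}"

definition factorization_product :: "('a, 'b) ring_scheme \<Rightarrow> 'a set multiset \<Rightarrow> 'a set" where
  "factorization_product R z =
    (let M = reduced_monoid (mult_of R)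
     in finprod M (\<lambda>a. a [^]\<^bsub>M\<^esub> count z a) (set_mset z))"

definition factorizations :: "('a, 'b) ring_scheme \<Rightarrow> 'a \<Rightarrow> 'a set multiset set" where
  "factorizations R g =
    {z \<in> factorization_monoid R.
      factorization_product R z = Units (mult_of R) #>\<^bsub>mult_of R\<^esub> g}"

definition factorizations_of_length ::
    "('a, 'b) ring_scheme \<Rightarrow> nat \<Rightarrow> 'a \<Rightarrow> 'a set multiset set" where
  "factorizations_of_length R k g = {z \<in> factorizations R g. size z = k}"

definition set_of_lengths :: "('a, 'b) ring_scheme \<Rightarrow> 'a \<Rightarrow> nat set" where
  "set_of_lengths R g = size ` factorizations R g"

definition squarefree_in :: "('a, 'b) ring_scheme \<Rightarrow> 'a \<Rightarrow> bool" where
  "squarefree_in R g \<longleftrightarrow>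
    g \<in> carrier R - {\<zero>\<^bsub>R\<^esub>} \<and>
    \<not> (\<exists>b\<in>carrier R - Units R. \<exists>c\<in>carrier R. g = (b \<otimes>\<^bsub>R\<^esub> b) \<otimes>\<^bsub>R\<^esub> c)"

end

theory Submission
  imports Defs
begin

text \<open>
  The element \<open>g\<close> is a monomial \<open>X\<^sup>h\<close>. In \<open>K[X]\<close> every divisor of a monomial is a monomial
  (\<open>divisor_of_monom\<close>), so up to associates the factorizations of \<open>X\<^sup>h\<close> in \<open>K[H]\<close> are the
  factorizations of the integer \<open>h\<close> in the additive monoid \<open>H\<close>, and the field no longer matters.
  Formally, \<open>n \<mapsto> X\<^sup>n\<close> embeds \<open>H\<close> in the reduced monoid of \<open>K[H]\<close> with an image that is closed
  under divisors (\<open>monom_embedding\<close>), and such an embedding preserves atoms and factorizations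
  (\<open>factorizations_eq_image\<close>).

  It remains to find \<open>H\<close> and \<open>h\<close>. For a finite set \<open>J\<close> and lengths \<open>k j \<ge> 2\<close>, consider the abelian
  group with generators \<open>h\<close> and \<open>a (j, t)\<close> for \<open>j \<in> J\<close>, \<open>t < k j\<close>, and with the relations
  \<open>(\<Sum>t<k j. a (j, t)) = h\<close>. It is free, a basis being \<open>h\<close> together with the \<open>a (j, t)\<close> for \<open>t \<ge> 1\<close>.
  If \<open>(\<Sum>s. c s * a s) = h\<close> with coefficients \<open>c s \<ge> 0\<close>, comparing coordinates shows that \<open>c (j, t)\<close>
  does not depend on \<open>t\<close> and that \<open>(\<Sum>j. c (j, 0)) = 1\<close>; so the \<open>|J|\<close> defining relations are the only
  ways to write \<open>h\<close> as a sum of generators \<open>a s\<close>. The same behaviour is available with positive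
  integers (\<open>prescribed_representations\<close>): only finitely many \<open>c\<close> can occur once all \<open>a s\<close> have
  the order of magnitude of \<open>h\<close>, and on a bounded set of coefficients the free group can be
  replaced by integers with a rapidly growing basis (\<open>independent_weights\<close>).

  Then \<open>H\<close> consists of the sums of the \<open>a s\<close> and of all integers above \<open>h\<close>; the latter make the
  complement finite and do not divide \<open>h\<close>. Uniqueness of the representations also yields that the
  \<open>a s\<close> are distinct atoms and that \<open>h\<close> is squarefree. The theorem is the case in which \<open>J\<close> has
  \<open>f k\<close> elements of length \<open>k\<close>, for each \<open>k \<in> L\<close>.
\<close>

section \<open>Integers with prescribed representations\<close>

text \<open>
  The weights are like the powers of \<open>B\<close>, with \<open>T\<close> the next power: digits smaller than \<open>B\<close> in absolute
  value can represent zero only trivially, since the lowest nonzero one would be divisible by \<open>B\<close>.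
  The top digit \<open>D\<close> is unrestricted. Building the weights along the finite set \<open>S\<close> avoids
  enumerating it.
\<close>

lemma independent_weights:
  fixes B :: int
  assumes "finite S" and "B \<ge> 2"
  shows "\<exists>(w :: 's \<Rightarrow> int) T. (\<forall>s\<in>S. 0 \<le> w s) \<and> sum w S < T \<and>
    (\<forall>d D. (\<forall>s\<in>S. \<bar>d s\<bar> < B) \<longrightarrow> (\<Sum>s\<in>S. d s * w s) + D * T = 0 \<longrightarrow> (\<forall>s\<in>S. d s = 0) \<and> D = 0)"
  using assms(1)
proof (induction S rule: finite_induct)
  case empty
  show ?case by (rule exI, rule exI[of _ 1]) simp
next
  case (insert x S)
  then obtain w :: "'s \<Rightarrow> int" and T where w: "\<forall>s\<in>S. 0 \<le> w s" "sum w S < T"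
    and ind: "\<And>d D. \<lbrakk>\<forall>s\<in>S. \<bar>d s\<bar> < B; (\<Sum>s\<in>S. d s * w s) + D * T = 0\<rbrakk>
      \<Longrightarrow> (\<forall>s\<in>S. d s = 0) \<and> D = 0"
    by blast
  \<comment> \<open>The old top weight becomes the weight of \<open>x\<close>, and \<open>B * T\<close> is the new top weight.\<close>
  define w' where "w' = w(x := T)"
  have w'_eq: "w' x = T" "\<And>s. s \<in> S \<Longrightarrow> w' s = w s"
    using insert.hyps by (auto simp: w'_def)
  have "T > 0"
    using w sum_nonneg[of S w] by force
  have sum_w': "(\<Sum>s\<in>insert x S. d s * w' s) = d x * T + (\<Sum>s\<in>S. d s * w s)" for d
    using insert.hyps w'_eq by simp
  have "sum w' (insert x S) < 2 * T"
    using sum_w'[of "\<lambda>_. 1"] w by simp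
  also have "\<dots> \<le> B * T"
    using \<open>B \<ge> 2\<close> \<open>T > 0\<close> by (intro mult_right_mono) auto
  finally have "sum w' (insert x S) < B * T" .
  moreover have "\<forall>s\<in>insert x S. 0 \<le> w' s"
    using w \<open>T > 0\<close> w'_eq by auto
  moreover have "(\<forall>s\<in>insert x S. d s = 0) \<and> D = 0"
    if d: "\<forall>s\<in>insert x S. \<bar>d s\<bar> < B" and zero: "(\<Sum>s\<in>insert x S. d s * w' s) + D * (B * T) = 0" for d D
  proof -
    have "(\<Sum>s\<in>S. d s * w s) + (d x + D * B) * T = 0"
      using zero unfolding sum_w' by (simp add: algebra_simps)
    moreover have "\<forall>s\<in>S. \<bar>d s\<bar> < B"
      using d by simp
    ultimately have "\<forall>s\<in>S. d s = 0" and "d x + D * B = 0"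
      using ind by blast+
    moreover from this have "B dvd d x"
      by (metis add.commute add_eq_0_iff dvd_minus_iff dvd_triv_right)
    then have "d x = 0"
      using d zdvd_not_zless[of "\<bar>d x\<bar>" B] by fastforce
    ultimately show ?thesis
      using \<open>B \<ge> 2\<close> by simp
  qed
  ultimately show ?case by blast
qed

text \<open>
  With \<open>w\<close>, \<open>T\<close> from the preceding lemma, \<open>h = M * T\<close> and \<open>a (j, t) = T + w (j, t)\<close> for \<open>t \<ge> 1\<close>, while
  \<open>a (j, 0)\<close> is what is missing to the sum \<open>h\<close>. The summand \<open>T\<close> is there to bound the coefficients: all
  \<open>a s\<close> are at least \<open>T\<close>, so a representation of \<open>h\<close> has coefficients at most \<open>M\<close>, and the weights
  behave like independent vectors. The digit of \<open>w (j, t)\<close> in the difference of the two sides is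
  \<open>c (j, t) - c (j, 0)\<close>; that all these vanish and that the digit of \<open>T\<close> vanishes means exactly that
  \<open>c\<close> is the indicator function of one block \<open>{j} \<times> {..<k j}\<close>.
\<close>

lemma prescribed_representations:
  fixes J :: "'j set" and k :: "'j \<Rightarrow> nat"
  assumes "finite J" and k2: "\<And>j. j \<in> J \<Longrightarrow> k j \<ge> 2"
  obtains a :: "'j \<times> nat \<Rightarrow> nat" and h
  where "\<And>s. s \<in> (SIGMA j:J. {..<k j}) \<Longrightarrow> 0 < a s"
    and "\<And>c. (\<Sum>s \<in> (SIGMA j:J. {..<k j}). c s * a s) = h \<longleftrightarrow>
      (\<exists>j\<in>J. \<forall>s \<in> (SIGMA j:J. {..<k j}). c s = of_bool (fst s = j))"
proof -
  define I where "I = (SIGMA j:J. {..<k j})"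
  define S where "S = (SIGMA j:J. {1..<k j})"
  \<comment> \<open>Any \<open>M > k j\<close> for all \<open>j\<close> would do: it makes \<open>a (j, 0)\<close> at least \<open>2 * T\<close> minus a sum of weights.\<close>
  define M where "M = int (1 + (\<Sum>j\<in>J. k j))"
  have "finite I" "finite S"
    using \<open>finite J\<close> by (auto simp: I_def S_def)
  have M: "M - int (k j) \<ge> 1" if "j \<in> J" for j
    using member_le_sum[of j J "\<lambda>j. int (k j)"] \<open>finite J\<close> that by (simp add: M_def)
  have "M \<ge> 1" by (simp add: M_def sum_nonneg)
  then obtain w :: "'j \<times> nat \<Rightarrow> int" and T where w: "\<forall>s\<in>S. 0 \<le> w s" "sum w S < T"
    and ind: "\<And>d D. \<lbrakk>\<forall>s\<in>S. \<bar>d s\<bar> < M + 1; (\<Sum>s\<in>S. d s * w s) + D * T = 0\<rbrakk>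
      \<Longrightarrow> (\<forall>s\<in>S. d s = 0) \<and> D = 0"
    using independent_weights[of S "M + 1"] \<open>finite S\<close> by (smt (verit, del_insts))
  have "T > 0"
    using w sum_nonneg[of S w] by force
  define b where "b = (\<lambda>(j, t). if t = 0 then (M - int (k j) + 1) * T - (\<Sum>t=1..<k j. w (j, t))
    else T + w (j, t))"
  have b_ge: "T \<le> b s" if s_in: "s \<in> I" for s
  proof -
    obtain j t where s: "s = (j, t)" "j \<in> J" "t < k j"
      using s_in by (auto simp: I_def)
    have "(\<Sum>t=1..<k j. w (j, t)) = sum w (Pair j ` {1..<k j})"
      by (subst sum.reindex) (auto simp: inj_on_def)
    also have "\<dots> \<le> sum w S"
      using w s \<open>finite S\<close> by (intro sum_mono2) (auto simp: S_def)
    finally have "(\<Sum>t=1..<k j. w (j, t)) \<le> T" using w by simp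
    moreover have "2 * T \<le> (M - int (k j) + 1) * T"
      using M[OF \<open>j \<in> J\<close>] \<open>T > 0\<close> by (intro mult_right_mono) auto
    moreover have "t \<noteq> 0 \<Longrightarrow> 0 \<le> w (j, t)"
      using w s by (auto simp: S_def)
    ultimately show ?thesis
      by (auto simp: s b_def)
  qed
  have total: "(\<Sum>s\<in>I. c s * b s) =
      (\<Sum>(j, t)\<in>S. (c (j, t) - c (j, 0)) * w (j, t)) +
      ((\<Sum>(j, t)\<in>S. c (j, t) - c (j, 0)) + M * (\<Sum>j\<in>J. c (j, 0))) * T" for c :: "'j \<times> nat \<Rightarrow> int"
  proof -
    have row: "(\<Sum>t<k j. c (j, t) * b (j, t)) =
      (\<Sum>t=1..<k j. (c (j, t) - c (j, 0)) * w (j, t)) +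
      ((\<Sum>t=1..<k j. c (j, t) - c (j, 0)) + M * c (j, 0)) * T" if "j \<in> J" for j
    proof -
      have "{..<k j} = insert 0 {1..<k j}"
        using k2[OF that] by auto
      then have "(\<Sum>t<k j. c (j, t) * b (j, t)) =
          c (j, 0) * b (j, 0) + (\<Sum>t=1..<k j. c (j, t) * b (j, t))"
        by simp
      also have "(\<Sum>t=1..<k j. c (j, t) * b (j, t)) = (\<Sum>t=1..<k j. c (j, t) * (T + w (j, t)))"
        by (intro sum.cong) (auto simp: b_def)
      finally show ?thesis
        using k2[OF that]
        by (simp add: b_def sum.distrib sum_subtractf sum_distrib_left sum_distrib_right of_nat_diff algebra_simps)
    qed
    have "(\<Sum>s\<in>I. c s * b s) = (\<Sum>j\<in>J. \<Sum>t<k j. c (j, t) * b (j, t))"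
      using \<open>finite J\<close> by (simp add: I_def sum.Sigma case_prod_unfold)
    also have "\<dots> = (\<Sum>j\<in>J. (\<Sum>t=1..<k j. (c (j, t) - c (j, 0)) * w (j, t)) +
      ((\<Sum>t=1..<k j. c (j, t) - c (j, 0)) + M * c (j, 0)) * T)"
      by (intro sum.cong refl row)
    also have "\<dots> = (\<Sum>j\<in>J. (\<Sum>t=1..<k j. (c (j, t) - c (j, 0)) * w (j, t))) +
      ((\<Sum>j\<in>J. \<Sum>t=1..<k j. c (j, t) - c (j, 0)) + M * (\<Sum>j\<in>J. c (j, 0))) * T"
      by (simp only: sum.distrib sum_distrib_left[symmetric] sum_distrib_right[symmetric])
    finally show ?thesis
      using \<open>finite J\<close> by (simp add: S_def sum.Sigma)
  qed
  define a where "a = (\<lambda>s. nat (b s))"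
  have int_a: "int (a s) = b s" if "s \<in> I" for s
    using b_ge[OF that] \<open>T > 0\<close> by (simp add: a_def)
  have reps: "(\<Sum>s\<in>I. c s * a s) = nat (M * T) \<longleftrightarrow>
      (\<exists>j\<in>J. \<forall>s\<in>I. c s = of_bool (fst s = j))" for c
  proof -
    define d where "d = (\<lambda>(j, t). int (c (j, t)) - int (c (j, 0)))"
    have total_c: "(\<Sum>s\<in>I. int (c s) * b s) =
        (\<Sum>s\<in>S. d s * w s) + (sum d S + M * (\<Sum>j\<in>J. int (c (j, 0)))) * T"
      unfolding d_def total[of "\<lambda>s. int (c s)"] by (simp only: case_prod_unfold prod.collapse)
    have J0: "(j, 0) \<in> I" if "j \<in> J" for j
      using k2[OF that] that by (auto simp: I_def)
    have "(\<Sum>s\<in>I. c s * a s) = nat (M * T) \<longleftrightarrow> (\<Sum>s\<in>I. int (c s) * b s) = M * T"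
    proof -
      have "(\<Sum>s\<in>I. int (c s) * b s) = int (\<Sum>s\<in>I. c s * a s)"
        by (simp add: int_a)
      moreover have "0 \<le> M * T"
        using \<open>M \<ge> 1\<close> \<open>T > 0\<close> by simp
      ultimately show ?thesis
        unfolding nat_eq_iff2 by presburger
    qed
    also have "\<dots> \<longleftrightarrow> (\<forall>s\<in>S. d s = 0) \<and> (\<Sum>j\<in>J. c (j, 0)) = 1"
    proof
      assume eq: "(\<Sum>s\<in>I. int (c s) * b s) = M * T"
      have c_le: "int (c s) \<le> M" if "s \<in> I" for s
      proof -
        have "int (c s) * T \<le> int (c s) * b s"
          using b_ge[OF that] by (intro mult_left_mono) auto
        also have "\<dots> \<le> (\<Sum>s\<in>I. int (c s) * b s)"
        proof (rule member_le_sum[OF that])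
          show "0 \<le> int (c s) * b s" if "s \<in> I - {s'}" for s s'
            using that b_ge[of s] \<open>T > 0\<close> by simp
        qed (rule \<open>finite I\<close>)
        finally show ?thesis
          using eq \<open>T > 0\<close> by simp
      qed
      have "\<bar>d s\<bar> < M + 1" if s_in: "s \<in> S" for s
      proof -
        obtain j t where s: "s = (j, t)" "j \<in> J" "(j, t) \<in> I"
          using s_in by (auto simp: S_def I_def)
        show ?thesis
          using c_le[OF s(3)] c_le[OF J0[OF s(2)]] by (simp add: s(1) d_def)
      qed
      moreover have "(\<Sum>s\<in>S. d s * w s) + (sum d S + M * ((\<Sum>j\<in>J. int (c (j, 0))) - 1)) * T = 0"
        using eq unfolding total_c by (simp add: algebra_simps)
      ultimately have *: "\<forall>s\<in>S. d s = 0" "sum d S + M * ((\<Sum>j\<in>J. int (c (j, 0))) - 1) = 0"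
        using ind by blast+
      then have "int (\<Sum>j\<in>J. c (j, 0)) = 1"
        using \<open>M \<ge> 1\<close> by auto
      then show "(\<forall>s\<in>S. d s = 0) \<and> (\<Sum>j\<in>J. c (j, 0)) = 1"
        using * by linarith
    next
      assume *: "(\<forall>s\<in>S. d s = 0) \<and> (\<Sum>j\<in>J. c (j, 0)) = 1"
      then have "(\<Sum>j\<in>J. int (c (j, 0))) = 1"
        by (metis of_nat_1 of_nat_sum)
      moreover have "(\<Sum>s\<in>S. d s * w s) = 0" "sum d S = 0"
        using * by auto
      ultimately show "(\<Sum>s\<in>I. int (c s) * b s) = M * T"
        unfolding total_c by simp
    qed
    also have "\<dots> \<longleftrightarrow> (\<exists>j\<in>J. \<forall>s\<in>I. c s = of_bool (fst s = j))"
    proof -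
      have "(\<forall>s\<in>S. d s = 0) \<longleftrightarrow> (\<forall>j\<in>J. \<forall>t\<in>{..<k j}. c (j, t) = c (j, 0))"
      proof -
        have "(\<forall>s\<in>S. d s = 0) \<longleftrightarrow> (\<forall>j\<in>J. \<forall>t\<in>{1..<k j}. c (j, t) = c (j, 0))"
          unfolding S_def d_def by simp
        also have "\<dots> \<longleftrightarrow> (\<forall>j\<in>J. \<forall>t\<in>{..<k j}. c (j, t) = c (j, 0))"
          by (metis atLeastLessThan_iff lessThan_iff less_one not_less)
        finally show ?thesis .
      qed
      moreover have "(\<Sum>j\<in>J. c (j, 0)) = 1 \<longleftrightarrow> (\<exists>i\<in>J. \<forall>j\<in>J. c (j, 0) = of_bool (j = i))"
        unfolding sum_eq_1_iff[OF \<open>finite J\<close>] by (intro bex_cong refl) auto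
      moreover have "(\<forall>j\<in>J. \<forall>t\<in>{..<k j}. c (j, t) = c (j, 0)) \<and> (\<forall>j\<in>J. c (j, 0) = of_bool (j = i)) \<longleftrightarrow>
          (\<forall>s\<in>I. c s = of_bool (fst s = i))" for i
      proof -
        have "(\<forall>s\<in>I. c s = of_bool (fst s = i)) \<longleftrightarrow> (\<forall>j\<in>J. \<forall>t\<in>{..<k j}. c (j, t) = of_bool (j = i))"
          unfolding I_def by simp
        moreover have "0 < k j" if "j \<in> J" for j
          using k2[OF that] by simp
        ultimately show ?thesis
          by (metis lessThan_iff)
      qed
      ultimately show ?thesis
        by blast
    qed
    finally show ?thesis .
  qed
  have pos: "0 < a s" if "s \<in> I" for s
    using int_a[OF that] b_ge[OF that] \<open>T > 0\<close> by simp
  show thesis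
    using pos reps by (rule that[folded I_def])
qed

section \<open>Numerical monoids with prescribed factorizations\<close>

definition numerical_atoms :: "nat set \<Rightarrow> nat set" where
  "numerical_atoms H = {n \<in> H. n \<noteq> 0 \<and> (\<forall>b\<in>H. \<forall>c\<in>H. b + c = n \<longrightarrow> b = 0 \<or> c = 0)}"

lemma sum_mset_image_eq_sum_count:
  fixes a :: "'s \<Rightarrow> nat"
  assumes "finite I" and "set_mset N \<subseteq> I"
  shows "sum_mset (image_mset a N) = (\<Sum>s\<in>I. count N s * a s)"
  using assms(2)
proof (induction N)
  case (add x N)
  have "(\<Sum>s\<in>I. count (add_mset x N) s * a s) = (\<Sum>s\<in>I. (if s = x then a s else 0) + count N s * a s)"
    by (intro sum.cong) auto
  also have "\<dots> = a x + (\<Sum>s\<in>I. count N s * a s)"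
    using add.prems \<open>finite I\<close> by (simp add: sum.distrib)
  finally show ?case
    using add by simp
qed simp

text \<open>
  Since the blocks \<open>{j} \<times> {..<k j}\<close> are the only representations of \<open>h\<close>, each \<open>a s\<close> is represented
  only by itself: a representation of \<open>a s\<close> together with the other members of the block of \<open>s\<close> is
  a representation of \<open>h\<close>, and it has to be the same block because \<open>k j \<ge> 2\<close> leaves at least one
  other member. Hence the \<open>a s\<close> are distinct and are atoms, and a representation \<open>h = 2 * b + c\<close>
  is impossible for \<open>b \<noteq> 0\<close> because all coefficients in the representations of \<open>h\<close> are at most 1.
\<close>

lemma numerical_monoid_prescribed_factorizations:
  fixes J :: "'j set" and k :: "'j \<Rightarrow> nat"
  assumes "finite J" and "J \<noteq> {}" and k2: "\<And>j. j \<in> J \<Longrightarrow> k j \<ge> 2"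
  obtains H h and \<zeta> :: "'j \<Rightarrow> nat multiset"
  where "numerical_monoid H" and "h \<in> H"
    and "\<And>b c. \<lbrakk>b \<in> H; c \<in> H; 2 * b + c = h\<rbrakk> \<Longrightarrow> b = 0"
    and "{N. set_mset N \<subseteq> numerical_atoms H \<and> sum_mset N = h} = \<zeta> ` J"
    and "inj_on \<zeta> J" and "\<And>j. j \<in> J \<Longrightarrow> size (\<zeta> j) = k j"
proof -
  define I where "I = (SIGMA j:J. {..<k j})"
  have "finite I"
    using \<open>finite J\<close> by (simp add: I_def)
  obtain a :: "'j \<times> nat \<Rightarrow> nat" and h where pos: "\<And>s. s \<in> I \<Longrightarrow> 0 < a s"
    and reps: "\<And>c. (\<Sum>s\<in>I. c s * a s) = h \<longleftrightarrow> (\<exists>j\<in>J. \<forall>s\<in>I. c s = of_bool (fst s = j))"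
    by (rule prescribed_representations[OF \<open>finite J\<close>, of k, folded I_def]) (erule k2, rule that)
  define val where "val c = (\<Sum>s\<in>I. c s * a s)" for c
  have val_add: "val (\<lambda>s. c s + d s) = val c + val d" for c d
    by (simp add: val_def sum.distrib algebra_simps)
  have val_single: "val (\<lambda>u. of_bool (u = s)) = a s" if "s \<in> I" for s
    using that \<open>finite I\<close> by (simp add: val_def of_bool_def if_distrib[where f = "\<lambda>x. x * _"] cong: if_cong)
  have val_zero: "val c = 0" if "\<And>s. s \<in> I \<Longrightarrow> c s = 0" for c
    using that by (simp add: val_def)
  have reps_val: "val c = h \<longleftrightarrow> (\<exists>j\<in>J. \<forall>s\<in>I. c s = of_bool (fst s = j))" for c
    by (simp add: val_def reps)
  have val_block: "val (\<lambda>s. of_bool (fst s = j)) = h" if "j \<in> J" for j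
    unfolding reps_val using that by blast
  have fst_I: "fst s \<in> J" if "s \<in> I" for s
    using that by (auto simp: I_def)

  have single: "c u = of_bool (u = s)" if "s \<in> I" "val c = a s" "u \<in> I" for c s u
  proof -
    have "val (\<lambda>u. c u + of_bool (fst u = fst s \<and> u \<noteq> s)) =
        val (\<lambda>u. of_bool (u = s) + of_bool (fst u = fst s \<and> u \<noteq> s))"
      using that val_add val_single by simp
    also have "(\<lambda>u. of_bool (u = s) + of_bool (fst u = fst s \<and> u \<noteq> s)) = (\<lambda>u. of_bool (fst u = fst s) :: nat)"
      by (auto simp: fun_eq_iff)
    also have "val \<dots> = h"
      using val_block fst_I that by blast
    finally obtain j where j: "j \<in> J"
      "\<And>u. u \<in> I \<Longrightarrow> c u + of_bool (fst u = fst s \<and> u \<noteq> s) = of_bool (fst u = j)"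
      unfolding reps_val by blast
    \<comment> \<open>another member of the block of \<open>s\<close>; it identifies \<open>j\<close>\<close>
    have "(fst s, if snd s = 0 then 1 else 0) \<in> I"
      using that(1) k2[OF fst_I[OF that(1)]] by (auto simp: I_def)
    from j(2)[OF this] have "fst s = j"
      by (cases s) (auto split: if_splits simp: of_bool_def)
    then show ?thesis
      using j(2)[OF \<open>u \<in> I\<close>] by (auto simp: of_bool_def split: if_splits)
  qed
  have inj_a: "inj_on a I"
  proof (rule inj_onI)
    fix s u assume "s \<in> I" "u \<in> I" "a s = a u"
    then show "s = u"
      using single[of u "\<lambda>v. of_bool (v = s)" s] val_single[of s]
      by (simp add: of_bool_def split: if_splits)
  qed
  have a_le: "a s \<le> h" if "s \<in> I" for s
  proof -
    have "of_bool (fst s = fst s) * a s \<le> val (\<lambda>u. of_bool (fst u = fst s))"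
      unfolding val_def using that \<open>finite I\<close>
      by (intro member_le_sum[where f = "\<lambda>u. of_bool (fst u = fst s) * a u"]) auto
    then show ?thesis
      using val_block[OF fst_I[OF that]] by simp
  qed

  define H where "H = range val \<union> {h<..}"
  have H_le: "\<exists>c. n = val c" if "n \<in> H" "n \<le> h" for n
    using that by (auto simp: H_def)
  have a_H: "a s \<in> H" if "s \<in> I" for s
    using val_single[OF that] unfolding H_def by (metis UnI1 rangeI)
  have "h \<in> H"
    using val_block \<open>J \<noteq> {}\<close> unfolding H_def by blast
  have numerical: "numerical_monoid H"
    unfolding numerical_monoid_def
  proof (intro conjI ballI)
    show "0 \<in> H"
      using val_zero[of "\<lambda>_. 0"] unfolding H_def by (metis UnI1 rangeI)
    show "finite (- H)"
      by (rule finite_subset[of _ "{..h}"]) (auto simp: H_def)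
    fix m n assume "m \<in> H" "n \<in> H"
    then show "m + n \<in> H"
      unfolding H_def using val_add[symmetric] by fastforce
  qed

  have atom_a: "a s \<in> numerical_atoms H" if s: "s \<in> I" for s
    unfolding numerical_atoms_def
  proof (intro CollectI conjI ballI impI)
    show "a s \<in> H" "a s \<noteq> 0"
      using a_H pos that by auto
    fix m n assume mn: "m \<in> H" "n \<in> H" "m + n = a s"
    then obtain c d where cd: "m = val c" "n = val d"
      using H_le a_le[OF s] by (metis le_add1 le_add2 le_trans)
    then have *: "c u + d u = of_bool (u = s)" if "u \<in> I" for u
      using single[OF \<open>s \<in> I\<close>, of "\<lambda>u. c u + d u" u] that mn(3) val_add by simp
    have "(\<forall>u\<in>I. c u = 0) \<or> (\<forall>u\<in>I. d u = 0)"
    proof (cases "c s = 0")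
      case True
      then show ?thesis using * by (metis add_eq_0_iff_both_eq_0 of_bool_eq(1))
    next
      case False
      then have "d s = 0" using *[OF that] by simp
      then show ?thesis using * by (metis add_eq_0_iff_both_eq_0 of_bool_eq(1))
    qed
    then show "m = 0 \<or> n = 0"
      using cd val_zero by metis
  qed
  have atom_cases: "n \<in> a ` I" if n: "n \<in> numerical_atoms H" "n \<le> h" for n
  proof -
    have "n \<in> H" "n \<noteq> 0"
      and split: "\<And>b c. \<lbrakk>b \<in> H; c \<in> H; n = b + c\<rbrakk> \<Longrightarrow> b = 0 \<or> c = 0"
      using n by (auto simp: numerical_atoms_def)
    then obtain c where c: "n = val c"
      using H_le n(2) by metis
    then obtain s where s: "s \<in> I" "c s \<noteq> 0"
      using val_zero[of c] \<open>n \<noteq> 0\<close> by auto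
    define d where "d u = c u - of_bool (u = s)" for u
    have "c = (\<lambda>u. of_bool (u = s) + d u)"
      using s(2) by (auto simp: d_def fun_eq_iff)
    then have "n = a s + val d"
      using c val_add[of "\<lambda>u. of_bool (u = s)" d] val_single[OF s(1)] by simp
    moreover have "val d \<in> H"
      by (simp add: H_def)
    ultimately have "val d = 0"
      using split[OF a_H[OF s(1)]] pos[OF s(1)] \<open>n = a s + val d\<close> by auto
    then show ?thesis
      using \<open>n = a s + val d\<close> s(1) by simp
  qed

  define block where "block j = mset_set {s \<in> I. fst s = j}" for j
  define \<zeta> where "\<zeta> j = image_mset a (block j)" for j
  have set_block: "set_mset (block j) = {s \<in> I. fst s = j}" for j
    using \<open>finite I\<close> by (simp add: block_def)
  have count_block: "count (block j) s = of_bool (fst s = j)" if "s \<in> I" for j s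
    using that \<open>finite I\<close> by (simp add: block_def count_mset_set')
  have factorizations: "{N. set_mset N \<subseteq> numerical_atoms H \<and> sum_mset N = h} = \<zeta> ` J"
  proof (intro equalityI subsetI)
    fix N assume "N \<in> \<zeta> ` J"
    then obtain j where j: "j \<in> J" "N = \<zeta> j" by blast
    have "sum_mset N = val (count (block j))"
      unfolding val_def j \<zeta>_def using \<open>finite I\<close> set_block
      by (intro sum_mset_image_eq_sum_count) auto
    also have "\<dots> = h"
      unfolding reps_val using j count_block by blast
    finally show "N \<in> {N. set_mset N \<subseteq> numerical_atoms H \<and> sum_mset N = h}"
      using atom_a set_block by (auto simp: j \<zeta>_def)
  next
    fix N assume "N \<in> {N. set_mset N \<subseteq> numerical_atoms H \<and> sum_mset N = h}"
    then have N: "set_mset N \<subseteq> numerical_atoms H" "sum_mset N = h" by auto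
    have "n \<le> h" if "n \<in># N" for n
      using multi_member_split[OF that] N(2) by auto
    then have "set_mset N \<subseteq> a ` I"
      using atom_cases N(1) by blast
    define N' where "N' = image_mset (inv_into I a) N"
    have N': "N = image_mset a N'" "set_mset N' \<subseteq> I"
    proof -
      have "image_mset a N' = image_mset (\<lambda>n. n) N"
        unfolding N'_def image_mset.compositionality
        using \<open>set_mset N \<subseteq> a ` I\<close> by (intro image_mset_cong) (auto simp: f_inv_into_f)
      then show "N = image_mset a N'" by simp
      show "set_mset N' \<subseteq> I"
        using \<open>set_mset N \<subseteq> a ` I\<close> by (auto simp: N'_def inv_into_into)
    qed
    have "val (count N') = h"
      using sum_mset_image_eq_sum_count[OF \<open>finite I\<close> N'(2), of a] N(2) N'(1) by (simp add: val_def)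
    then obtain j where j: "j \<in> J" "\<And>s. s \<in> I \<Longrightarrow> count N' s = of_bool (fst s = j)"
      unfolding reps_val by blast
    have "N' = block j"
    proof (rule multiset_eqI)
      fix s show "count N' s = count (block j) s"
      proof (cases "s \<in> I")
        case False
        then show ?thesis
          using N'(2) set_block by (metis (no_types, lifting) mem_Collect_eq not_in_iff subsetD)
      qed (simp add: j count_block)
    qed
    then show "N \<in> \<zeta> ` J"
      using j(1) N'(1) by (simp add: \<zeta>_def)
  qed
  have inj: "inj_on \<zeta> J"
  proof (rule inj_onI)
    fix i j assume ij: "i \<in> J" "j \<in> J" "\<zeta> i = \<zeta> j"
    have i0: "(i, 0) \<in> I"
      using k2[OF ij(1)] ij(1) by (auto simp: I_def)
    have "a ` {s \<in> I. fst s = i} = a ` {s \<in> I. fst s = j}"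
      using arg_cong[OF ij(3), of set_mset] by (simp add: \<zeta>_def set_block)
    then obtain s where "s \<in> I" "fst s = j" "a (i, 0) = a s"
      using i0 by fastforce
    then show "i = j"
      using inj_onD[OF inj_a, of "(i, 0)" s] i0 by auto
  qed
  have size: "size (\<zeta> j) = k j" if "j \<in> J" for j
  proof -
    have "{s \<in> I. fst s = j} = Pair j ` {..<k j}"
      using that by (auto simp: I_def)
    then show ?thesis
      by (simp add: \<zeta>_def block_def card_image inj_on_def)
  qed
  have squarefree: "b = 0" if bc: "b \<in> H" "c \<in> H" "2 * b + c = h" for b c
  proof -
    obtain d e where de: "b = val d" "c = val e"
      using H_le[of b] H_le[of c] bc by auto
    have "val (\<lambda>s. (d s + d s) + e s) = h"
      using bc(3) de by (simp add: val_add)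
    then obtain j where j: "\<And>s. s \<in> I \<Longrightarrow> (d s + d s) + e s = of_bool (fst s = j)"
      unfolding reps_val by blast
    have "d s = 0" if "s \<in> I" for s
      using j[OF that] by (cases "fst s = j") auto
    then show ?thesis
      unfolding de by (rule val_zero)
  qed
  show thesis
    using numerical \<open>h \<in> H\<close> squarefree factorizations inj size by (rule that)
qed

section \<open>Divisor-closed embeddings of additive monoids\<close>

text \<open>
  This recursion makes the product of a multiset, which is a product of powers over the distinct
  elements, accessible to induction on multisets.
\<close>

lemma (in comm_monoid) finprod_count_add_mset:
  assumes x: "x \<in> carrier G" and z: "set_mset z \<subseteq> carrier G"
  shows "finprod G (\<lambda>a. a [^] count (add_mset x z) a) (set_mset (add_mset x z)) =
    x \<otimes> finprod G (\<lambda>a. a [^] count z a) (set_mset z)"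
proof -
  let ?f = "\<lambda>a. a [^] count z a" and ?A = "set_mset z - {x}"
  have f: "?f \<in> ?A \<rightarrow> carrier G"
    using z by auto
  have "finprod G (\<lambda>a. a [^] count (add_mset x z) a) (insert x ?A) =
      x [^] Suc (count z x) \<otimes> finprod G (\<lambda>a. a [^] count (add_mset x z) a) ?A"
    using x z by (subst finprod_insert) auto
  also have "finprod G (\<lambda>a. a [^] count (add_mset x z) a) ?A = finprod G ?f ?A"
    using f by (intro finprod_cong') auto
  also have "x [^] Suc (count z x) \<otimes> finprod G ?f ?A = x \<otimes> (?f x \<otimes> finprod G ?f ?A)"
    using x f by (simp add: m_ac)
  also have "?f x \<otimes> finprod G ?f ?A = finprod G ?f (set_mset z)"
  proof (cases "x \<in># z")
    case True
    then have "finprod G ?f (set_mset z) = finprod G ?f (insert x ?A)"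
      by (simp add: insert_absorb)
    also have "\<dots> = ?f x \<otimes> finprod G ?f ?A"
      using x f by (subst finprod_insert) auto
    finally show ?thesis ..
  next
    case False
    then show ?thesis
      using f by (simp add: not_in_iff)
  qed
  finally show ?thesis by simp
qed

text \<open>
  All divisors of \<open>\<phi> n\<close> in \<open>M\<close> come from \<open>H\<close>, so every question about factorizations of \<open>\<phi> n\<close> is
  decided in \<open>H\<close>, although \<open>M\<close> itself may be much larger.
\<close>

locale divisor_closed_embedding = comm_monoid M for M (structure) +
  fixes H :: "nat set" and \<phi> :: "nat \<Rightarrow> 'a"
  assumes zero_H: "0 \<in> H"
    and add_H: "\<lbrakk>m \<in> H; n \<in> H\<rbrakk> \<Longrightarrow> m + n \<in> H"
    and closed: "n \<in> H \<Longrightarrow> \<phi> n \<in> carrier M"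
    and map_zero: "\<phi> 0 = \<one>"
    and map_add: "\<lbrakk>m \<in> H; n \<in> H\<rbrakk> \<Longrightarrow> \<phi> (m + n) = \<phi> m \<otimes> \<phi> n"
    and inj: "inj_on \<phi> H"
    and divisor: "\<lbrakk>x \<in> carrier M; y \<in> carrier M; x \<otimes> y \<in> \<phi> ` H\<rbrakk> \<Longrightarrow> x \<in> \<phi> ` H"
begin

lemma splitE:
  assumes "x \<in> carrier M" "y \<in> carrier M" "n \<in> H" "x \<otimes> y = \<phi> n"
  obtains b c where "b \<in> H" "c \<in> H" "x = \<phi> b" "y = \<phi> c" "n = b + c"
proof -
  have "x \<in> \<phi> ` H"
    using divisor[of x y] assms by simp
  moreover have "y \<in> \<phi> ` H"
    using divisor[of y x] m_comm[of y x] assms by simp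
  ultimately obtain b c where bc: "b \<in> H" "x = \<phi> b" "c \<in> H" "y = \<phi> c"
    by blast
  then have "n = b + c"
    using assms map_add add_H inj by (metis inj_onD)
  then show thesis using bc that by blast
qed

lemma Units_eq: "Units M = {\<one>}"
proof -
  have "x = \<one>" if unit: "x \<in> Units M" for x
  proof -
    obtain y where "x \<in> carrier M" "y \<in> carrier M" "x \<otimes> y = \<phi> 0"
      using unit map_zero by (auto simp: Units_def)
    then obtain b c where "b \<in> H" "c \<in> H" "x = \<phi> b" "y = \<phi> c" "0 = b + c"
      by (rule splitE[OF _ _ zero_H])
    then show ?thesis using map_zero by simp
  qed
  then show ?thesis using Units_one_closed by blast
qed

lemma irreducible_iff:
  assumes "n \<in> H"
  shows "Divisibility.irreducible M (\<phi> n) \<longleftrightarrow> n \<in> numerical_atoms H"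
proof
  have unit_iff: "\<phi> m \<in> Units M \<longleftrightarrow> m = 0" if "m \<in> H" for m
    using inj_onD[OF inj, of m 0] that zero_H map_zero by (auto simp: Units_eq)
  have proper_iff: "properfactor M (\<phi> m) (\<phi> (m + l)) \<longleftrightarrow> l \<noteq> 0" if ml: "m \<in> H" "l \<in> H" for m l
  proof -
    have "\<phi> m divides \<phi> (m + l)"
      using that map_add closed unfolding factor_def by blast
    moreover have "\<phi> (m + l) divides \<phi> m \<longleftrightarrow> l = 0"
    proof
      assume "\<phi> (m + l) divides \<phi> m"
      then obtain y where y: "y \<in> carrier M" "\<phi> (m + l) \<otimes> y = \<phi> m"
        unfolding factor_def by metis
      obtain b c where "b \<in> H" "c \<in> H" "\<phi> (m + l) = \<phi> b" "y = \<phi> c" "m = b + c"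
        by (rule splitE[OF closed[OF add_H[OF ml]] y(1) ml(1) y(2)])
      then show "l = 0"
        using inj_onD[OF inj, of "m + l" b] add_H[OF that] by auto
    next
      assume "l = 0"
      then show "\<phi> (m + l) divides \<phi> m"
        using closed that by simp
    qed
    ultimately show ?thesis
      by (simp add: properfactor_def)
  qed
  show "n \<in> numerical_atoms H" if irr: "Divisibility.irreducible M (\<phi> n)"
    unfolding numerical_atoms_def
  proof (intro CollectI conjI ballI impI)
    show "n \<noteq> 0"
      using irr unit_iff[OF assms] by (simp add: Divisibility.irreducible_def)
    fix b c assume bc: "b \<in> H" "c \<in> H" "b + c = n"
    then have "c \<noteq> 0 \<Longrightarrow> \<phi> b \<in> Units M"
      using irr proper_iff closed unfolding Divisibility.irreducible_def by blast
    then show "b = 0 \<or> c = 0"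
      using unit_iff bc by blast
  qed (fact assms)
  show "Divisibility.irreducible M (\<phi> n)" if atom: "n \<in> numerical_atoms H"
    unfolding Divisibility.irreducible_def
  proof (intro conjI ballI impI)
    show "\<phi> n \<notin> Units M"
      using atom unit_iff by (auto simp: numerical_atoms_def)
    fix x assume x: "x \<in> carrier M" "properfactor M x (\<phi> n)"
    then obtain y where y: "y \<in> carrier M" "x \<otimes> y = \<phi> n"
      unfolding properfactor_def factor_def by metis
    obtain b c where bc: "b \<in> H" "c \<in> H" "x = \<phi> b" "y = \<phi> c" "n = b + c"
      by (rule splitE[OF x(1) y(1) assms y(2)])
    then have "c \<noteq> 0"
      using x proper_iff by blast
    then show "x \<in> Units M"
      using atom bc unit_iff by (auto simp: numerical_atoms_def)
  qed
qed

lemma finprod_image_mset: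
  assumes "set_mset N \<subseteq> H"
  shows "sum_mset N \<in> H \<and>
    finprod M (\<lambda>a. a [^] count (image_mset \<phi> N) a) (set_mset (image_mset \<phi> N)) = \<phi> (sum_mset N)"
  using assms
proof (induction N)
  case empty
  then show ?case by (simp add: map_zero zero_H)
next
  case (add n N)
  then have "\<phi> n \<in> carrier M" "set_mset (image_mset \<phi> N) \<subseteq> carrier M"
    using closed by auto
  from finprod_count_add_mset[OF this] add show ?case
    by (simp add: map_add add_H)
qed

lemma finprod_eq_imageE:
  assumes "set_mset z \<subseteq> carrier M" and "n \<in> H"
    and "finprod M (\<lambda>a. a [^] count z a) (set_mset z) = \<phi> n"
  obtains N where "z = image_mset \<phi> N" "set_mset N \<subseteq> H" "sum_mset N = n"
proof -
  have "\<exists>N. z = image_mset \<phi> N \<and> set_mset N \<subseteq> H \<and> sum_mset N = n"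
    using assms
  proof (induction z arbitrary: n)
    case empty
    then have "\<phi> n = \<phi> 0"
      by (simp add: map_zero)
    then have "n = 0"
      using empty inj zero_H by (meson inj_onD)
    then show ?case by (intro exI[of _ "{#}"]) simp
  next
    case (add x z)
    have x: "x \<in> carrier M" and z: "set_mset z \<subseteq> carrier M"
      using add.prems by auto
    then have "finprod M (\<lambda>a. a [^] count z a) (set_mset z) \<in> carrier M"
      by (intro finprod_closed) auto
    moreover have "x \<otimes> finprod M (\<lambda>a. a [^] count z a) (set_mset z) = \<phi> n"
      using finprod_count_add_mset[OF x z] add.prems by simp
    ultimately obtain b c where bc: "b \<in> H" "c \<in> H" "x = \<phi> b"
      "finprod M (\<lambda>a. a [^] count z a) (set_mset z) = \<phi> c" "n = b + c"
      by (rule splitE[OF x _ \<open>n \<in> H\<close>])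
    then obtain N where "z = image_mset \<phi> N" "set_mset N \<subseteq> H" "sum_mset N = c"
      using add.IH[OF z] by metis
    then show ?case
      using bc by (intro exI[of _ "add_mset b N"]) simp
  qed
  then show thesis using that by blast
qed

lemma factorizations_eq_image:
  assumes "n \<in> H"
  shows "{z. set_mset z \<subseteq> atoms M \<and> finprod M (\<lambda>a. a [^] count z a) (set_mset z) = \<phi> n} =
    image_mset \<phi> ` {N. set_mset N \<subseteq> numerical_atoms H \<and> sum_mset N = n}"
proof (intro equalityI subsetI)
  fix z assume "z \<in> {z. set_mset z \<subseteq> atoms M \<and>
    finprod M (\<lambda>a. a [^] count z a) (set_mset z) = \<phi> n}"
  then have z: "set_mset z \<subseteq> atoms M"
    and prod: "finprod M (\<lambda>a. a [^] count z a) (set_mset z) = \<phi> n"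
    by auto
  have "set_mset z \<subseteq> carrier M"
    using z by (auto simp: atoms_def)
  then obtain N where N: "z = image_mset \<phi> N" "set_mset N \<subseteq> H" "sum_mset N = n"
    using finprod_eq_imageE[OF _ assms prod] by blast
  moreover have "m \<in> numerical_atoms H" if "m \<in># N" for m
    using that N z irreducible_iff[of m] by (auto simp: atoms_def)
  ultimately show "z \<in> image_mset \<phi> ` {N. set_mset N \<subseteq> numerical_atoms H \<and> sum_mset N = n}"
    by blast
next
  fix z assume "z \<in> image_mset \<phi> ` {N. set_mset N \<subseteq> numerical_atoms H \<and> sum_mset N = n}"
  then obtain N where N: "z = image_mset \<phi> N" "set_mset N \<subseteq> numerical_atoms H" "sum_mset N = n"
    by blast
  then have "set_mset N \<subseteq> H"
    by (auto simp: numerical_atoms_def)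
  moreover from this have "set_mset z \<subseteq> atoms M"
    using N irreducible_iff closed by (auto simp: atoms_def)
  ultimately show "z \<in> {z. set_mset z \<subseteq> atoms M \<and>
      finprod M (\<lambda>a. a [^] count z a) (set_mset z) = \<phi> n}"
    using finprod_image_mset[of N] N by simp
qed

end

section \<open>Monomials in semigroup algebras\<close>

text \<open>
  For a monomial the order at 0 and the degree agree. Both are additive and the order is at most
  the degree, so the equality passes to the factors of a product; and a polynomial whose order at
  0 is its degree is a monomial.
\<close>

lemma divisor_of_monom:
  fixes p q :: "'a::field poly"
  assumes "p * q = monom c n" and "c \<noteq> 0"
  obtains u m where "p = monom u m" "u \<noteq> 0"
proof -
  have nz: "p * q \<noteq> 0" "p \<noteq> 0" "q \<noteq> 0"
    using assms by (auto simp: monom_eq_0_iff)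
  have "order 0 p + order 0 q = n"
  proof -
    have "monom c n = [:c:] * [:- 0, 1:] ^ n"
      using monom_altdef[of c n] by simp
    then have "order 0 (monom c n) = n"
      using assms(2) nz assms(1) order_mult[of "[:c:]" "[:0, 1:] ^ n" 0] order_power_n_n[of 0 n]
        order_0I[of "[:c:]" 0] by simp
    then show ?thesis
      using order_mult[OF nz(1), of 0] assms by simp
  qed
  moreover have "degree p + degree q = n"
    using degree_mult_eq[OF nz(2,3)] assms by (simp add: degree_monom_eq)
  ultimately have "degree p \<le> order 0 p"
    using order_degree[OF nz(2), of 0] order_degree[OF nz(3), of 0] by linarith
  then have "monom 1 (degree p) dvd p"
    using nz(2) by (simp add: monom_1_dvd_iff)
  then have "p = monom (lead_coeff p) (degree p)"
    unfolding monom_1_dvd_iff' by (auto simp: poly_eq_iff coeff_eq_0 linorder_neq_iff)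
  then show thesis
    using that nz(2) by (metis leading_coeff_0_iff)
qed

lemma const_of_mult_eq_one:
  fixes p q :: "'a::field poly"
  assumes "p * q = 1"
  obtains u where "u \<noteq> 0" "p = [:u:]"
proof -
  have "p \<noteq> 0" "q \<noteq> 0" using assms by auto
  then have "degree p + degree q = 0"
    using degree_mult_eq[of p q] assms by simp
  then obtain u where "p = [:u:]" by (metis add_is_0 degree_eq_zeroE)
  then show thesis using that \<open>p \<noteq> 0\<close> by auto
qed

text \<open>
  The units of \<open>K[H]\<close> are the nonzero constants for every numerical monoid \<open>H\<close>, so the class of
  associates of \<open>p\<close> can be described without \<open>H\<close>.
\<close>

definition assoc_class :: "'a::field poly \<Rightarrow> 'a poly set" where
  "assoc_class p = {smult u p | u. u \<noteq> 0}"

lemma assoc_class_self: "p \<in> assoc_class p"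
  unfolding assoc_class_def by (intro CollectI exI[of _ 1]) simp

lemma assoc_class_smult:
  assumes "u \<noteq> 0"
  shows "assoc_class (smult u p) = assoc_class p"
proof (intro equalityI subsetI)
  fix x assume "x \<in> assoc_class (smult u p)"
  then obtain v where "v \<noteq> 0" "x = smult (v * u) p"
    unfolding assoc_class_def by auto
  then show "x \<in> assoc_class p"
    using assms unfolding assoc_class_def by force
next
  fix x assume "x \<in> assoc_class p"
  then obtain v where v: "v \<noteq> 0" "x = smult v p"
    unfolding assoc_class_def by auto
  then have "x = smult (v / u) (smult u p)" "v / u \<noteq> 0"
    using assms by simp_all
  then show "x \<in> assoc_class (smult u p)"
    unfolding assoc_class_def by blast
qed

context
  fixes H :: "nat set" and KH :: "'a::field poly ring"
  assumes H: "numerical_monoid H"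
  defines "KH \<equiv> semigroup_algebra H"
begin

lemma monom_in_semigroup_algebra:
  "u \<noteq> 0 \<Longrightarrow> monom u n \<in> carrier KH \<longleftrightarrow> n \<in> H"
  by (auto simp: KH_def semigroup_algebra_def)

lemma semigroup_algebra_simps:
  "mult KH = (*)" "\<one>\<^bsub>KH\<^esub> = 1" "\<zero>\<^bsub>KH\<^esub> = 0"
  by (simp_all add: KH_def semigroup_algebra_def)

lemma const_in_semigroup_algebra: "[:u:] \<in> carrier KH"
  using H by (auto simp: KH_def semigroup_algebra_def numerical_monoid_def coeff_pCons split: nat.splits)

lemma Units_semigroup_algebra: "Units KH = {[:u:] | u. u \<noteq> 0}"
proof (intro equalityI subsetI)
  fix p :: "'a poly" assume "p \<in> Units KH"
  then obtain q where "p * q = 1"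
    unfolding Units_def semigroup_algebra_simps by blast
  then show "p \<in> {[:u:] | u. u \<noteq> 0}"
    by (rule const_of_mult_eq_one) blast
next
  fix p :: "'a poly" assume "p \<in> {[:u:] | u. u \<noteq> 0}"
  then obtain u where u: "p = [:u:]" "u \<noteq> 0" by blast
  have "[:inverse u:] \<in> carrier KH" "[:inverse u:] * p = 1" "p * [:inverse u:] = 1"
    using u by (simp_all add: const_in_semigroup_algebra one_pCons)
  then show "p \<in> Units KH"
    unfolding Units_def semigroup_algebra_simps using const_in_semigroup_algebra u(1) by blast
qed

lemma Units_mult_of_semigroup_algebra: "Units (mult_of KH) = {[:u:] | u. u \<noteq> 0}"
proof -
  have "Units (mult_of KH) = Units KH - {0}"
    unfolding Units_def by (auto simp: semigroup_algebra_simps)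
  then show ?thesis
    unfolding Units_semigroup_algebra by auto
qed

lemma coset_eq: "Units (mult_of KH) #>\<^bsub>mult_of KH\<^esub> p = assoc_class p"
  unfolding r_coset_def Units_mult_of_semigroup_algebra assoc_class_def
  by (auto simp: semigroup_algebra_simps)

lemma assoc_class_mult: "assoc_class p <#>\<^bsub>mult_of KH\<^esub> assoc_class q = assoc_class (p * q)"
proof (intro equalityI subsetI)
  fix x assume "x \<in> assoc_class p <#>\<^bsub>mult_of KH\<^esub> assoc_class q"
  then obtain u v where "u \<noteq> 0" "v \<noteq> 0" "x = smult u p * smult v q"
    unfolding set_mult_def assoc_class_def by (auto simp: semigroup_algebra_simps)
  then have "u * v \<noteq> 0" "x = smult (u * v) (p * q)"
    by (simp_all add: ac_simps)
  then show "x \<in> assoc_class (p * q)"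
    unfolding assoc_class_def by blast
next
  fix x assume "x \<in> assoc_class (p * q)"
  then obtain u where "u \<noteq> 0" "x = smult u p * q"
    unfolding assoc_class_def by auto
  moreover from this have "smult u p \<in> assoc_class p"
    unfolding assoc_class_def by blast
  ultimately show "x \<in> assoc_class p <#>\<^bsub>mult_of KH\<^esub> assoc_class q"
    using assoc_class_self[of q] unfolding set_mult_def mult_mult_of semigroup_algebra_simps by blast
qed

lemma carrier_reduced: "carrier (reduced_monoid (mult_of KH)) = assoc_class ` (carrier KH - {0})"
  by (auto simp: reduced_monoid_def FactGroup_def RCOSETS_def coset_eq semigroup_algebra_simps)

lemma monom_embedding:
  "divisor_closed_embedding (reduced_monoid (mult_of KH)) H (\<lambda>n. assoc_class (monom 1 n))"
proof -
  interpret domain KH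
    unfolding KH_def by (rule domain_semigroup_algebra) (rule H)
  have "comm_monoid (mult_of KH)"
    by (rule comm_monoidI)
      (use integral m_closed one_closed m_assoc m_comm in \<open>auto simp: semigroup_algebra_simps\<close>)
  then interpret M: comm_monoid "reduced_monoid (mult_of KH)"
    by (rule comm_monoid_reduced_monoid)
  have mult: "mult (reduced_monoid (mult_of KH)) (assoc_class p) (assoc_class q) = assoc_class (p * q)" for p q
    by (simp add: reduced_monoid_def FactGroup_def assoc_class_mult)
  show ?thesis
  proof
    show "0 \<in> H"
      using H by (simp add: numerical_monoid_def)
    show "m + n \<in> H" if "m \<in> H" "n \<in> H" for m n
      using H that by (simp add: numerical_monoid_def)
    show "assoc_class (monom 1 n) \<in> carrier (reduced_monoid (mult_of KH))" if "n \<in> H" for n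
      using that unfolding carrier_reduced by (auto simp: monom_in_semigroup_algebra monom_eq_0_iff)
    show "assoc_class (monom 1 0) = \<one>\<^bsub>reduced_monoid (mult_of KH)\<^esub>"
      by (auto simp: reduced_monoid_def FactGroup_def Units_mult_of_semigroup_algebra assoc_class_def monom_0)
    show "assoc_class (monom 1 (m + n)) =
        assoc_class (monom 1 m) \<otimes>\<^bsub>reduced_monoid (mult_of KH)\<^esub> assoc_class (monom 1 n)" for m n
      by (simp add: mult mult_monom)
    show "inj_on (\<lambda>n. assoc_class (monom (1 :: 'a) n)) H"
    proof (rule inj_onI)
      fix m n assume "assoc_class (monom 1 m) = assoc_class (monom (1 :: 'a) n)"
      moreover have "monom (1 :: 'a) m \<in> assoc_class (monom 1 m)"
        by (rule assoc_class_self)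
      ultimately obtain u where "monom (1 :: 'a) m = smult u (monom 1 n)" "u \<noteq> 0"
        unfolding assoc_class_def by auto
      then show "m = n"
        by (metis degree_monom_eq degree_smult_eq one_neq_zero)
    qed
    fix x y assume "x \<in> carrier (reduced_monoid (mult_of KH))" "y \<in> carrier (reduced_monoid (mult_of KH))"
      and xy: "x \<otimes>\<^bsub>reduced_monoid (mult_of KH)\<^esub> y \<in> (\<lambda>n. assoc_class (monom 1 n)) ` H"
    then obtain p q where p: "p \<in> carrier KH" "x = assoc_class p" and q: "y = assoc_class q"
      unfolding carrier_reduced by blast
    obtain n where "assoc_class (p * q) = assoc_class (monom 1 n)"
      using xy unfolding p q mult by blast
    moreover have "p * q \<in> assoc_class (p * q)"
      by (rule assoc_class_self)
    ultimately obtain u where "p * q = monom u n" "u \<noteq> 0"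
      unfolding assoc_class_def by (auto simp: smult_monom)
    then obtain v m where v: "p = monom v m" "v \<noteq> 0"
      by (rule divisor_of_monom)
    then have "x = assoc_class (monom 1 m)"
      using p assoc_class_smult[OF v(2), of "monom 1 m"] by (simp add: smult_monom)
    moreover have "m \<in> H"
      using p v monom_in_semigroup_algebra by blast
    ultimately show "x \<in> (\<lambda>n. assoc_class (monom 1 n)) ` H" by blast
  qed
qed

lemma factorizations_monom:
  assumes "n \<in> H"
  shows "factorizations KH (monom 1 n) = image_mset (\<lambda>n. assoc_class (monom 1 n)) `
    {N. set_mset N \<subseteq> numerical_atoms H \<and> sum_mset N = n}"
proof -
  interpret divisor_closed_embedding "reduced_monoid (mult_of KH)" H "\<lambda>n. assoc_class (monom 1 n)"
    by (rule monom_embedding)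
  show ?thesis
    unfolding factorizations_eq_image[OF assms, symmetric]
    by (simp add: factorizations_def factorization_monoid_def factorization_product_def coset_eq Let_def)
qed

text \<open>
  If \<open>p\<^sup>2 * q = X\<^sup>n\<close>, then \<open>p\<close> and \<open>q\<close> are monomials, so the exponents \<open>b\<close>, \<open>c\<close> satisfy \<open>2 * b + c = n\<close>,
  and \<open>b = 0\<close> says that \<open>p\<close> is a unit.
\<close>

lemma squarefree_monom:
  assumes "n \<in> H" and sf: "\<And>b c. \<lbrakk>b \<in> H; c \<in> H; 2 * b + c = n\<rbrakk> \<Longrightarrow> b = 0"
  shows "squarefree_in KH (monom 1 n)"
  unfolding squarefree_in_def
proof (intro conjI notI)
  show "monom 1 n \<in> carrier KH - {\<zero>\<^bsub>KH\<^esub>}"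
    using assms by (simp add: monom_in_semigroup_algebra semigroup_algebra_simps monom_eq_0_iff)
  assume "\<exists>b\<in>carrier KH - Units KH. \<exists>c\<in>carrier KH. monom 1 n = (b \<otimes>\<^bsub>KH\<^esub> b) \<otimes>\<^bsub>KH\<^esub> c"
  then obtain p q where p: "p \<in> carrier KH" "p \<notin> Units KH" and q: "q \<in> carrier KH"
    and eq: "monom 1 n = p * p * q"
    by (auto simp: semigroup_algebra_simps)
  have "p * (p * q) = monom 1 n" "q * (p * p) = monom 1 n"
    using eq by (simp_all add: ac_simps)
  then obtain u v b c where u: "p = monom u b" "u \<noteq> 0" and v: "q = monom v c" "v \<noteq> 0"
    using divisor_of_monom[OF _ one_neq_zero] by metis
  then have "monom (u * u * v) (2 * b + c) = monom 1 n"
    using eq by (simp add: mult_monom mult_2)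
  then have "2 * b + c = n"
    using u v by (metis degree_monom_eq mult_eq_0_iff one_neq_zero)
  moreover have "b \<in> H" "c \<in> H"
    using p q u v monom_in_semigroup_algebra by blast+
  ultimately have "b = 0"
    using sf by blast
  then show False
    using p u by (auto simp: Units_semigroup_algebra monom_0)
qed

end

section \<open>The realization theorem\<close>

theorem corollary3p5:
  fixes L :: "nat set" and f :: "nat \<Rightarrow> nat"
  assumes "finite L" and "L \<noteq> {}" and "\<forall>k\<in>L. k \<ge> 2"
    and "\<forall>k\<in>L. f k \<ge> 1"
  shows "\<exists>(H :: nat set) (g :: 'a::field poly).
    numerical_monoid H \<and>
    g \<in> carrier (semigroup_algebra H) \<and>
    squarefree_in (semigroup_algebra H) g \<and>
    set_of_lengths (semigroup_algebra H) g = L \<and>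
    (\<forall>k\<in>L. card (factorizations_of_length (semigroup_algebra H) k g) = f k)"
proof -
  \<comment> \<open>one index for each factorization that is wanted; the first component is its length\<close>
  define J where "J = (SIGMA k:L. {..<f k})"
  have J: "finite J" "\<And>j. j \<in> J \<Longrightarrow> fst j \<ge> 2" "fst ` J = L"
  proof -
    show "finite J" "\<And>j. j \<in> J \<Longrightarrow> fst j \<ge> 2"
      using assms by (auto simp: J_def)
    show "fst ` J = L"
      using assms(4) unfolding J_def fst_image_Sigma by (auto simp: lessThan_empty_iff)
  qed
  then have "J \<noteq> {}"
    using \<open>L \<noteq> {}\<close> by blast
  obtain H h and \<zeta> :: "nat \<times> nat \<Rightarrow> nat multiset" where H: "numerical_monoid H" "h \<in> H"
    and sf: "\<And>b c. \<lbrakk>b \<in> H; c \<in> H; 2 * b + c = h\<rbrakk> \<Longrightarrow> b = 0"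
    and facts: "{N. set_mset N \<subseteq> numerical_atoms H \<and> sum_mset N = h} = \<zeta> ` J"
    and inj: "inj_on \<zeta> J" and size: "\<And>j. j \<in> J \<Longrightarrow> size (\<zeta> j) = fst j"
    by (rule numerical_monoid_prescribed_factorizations[OF J(1) \<open>J \<noteq> {}\<close>, of fst]) (erule J(2), rule that)
  let ?R = "semigroup_algebra H :: 'a poly ring" and ?g = "monom (1 :: 'a) h"
  define cls where "cls n = assoc_class (monom (1 :: 'a) n)" for n
  define Z where "Z j = image_mset cls (\<zeta> j)" for j
  have fac: "factorizations ?R ?g = Z ` J"
    unfolding factorizations_monom[OF H] facts Z_def cls_def image_image ..
  have size_Z: "size (Z j) = fst j" if "j \<in> J" for j
    using size[OF that] by (simp add: Z_def)
  have inj_Z: "inj_on Z J"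
  proof (rule inj_onI)
    fix i j assume ij: "i \<in> J" "j \<in> J" "Z i = Z j"
    have "inj_on cls H"
      using divisor_closed_embedding.inj[OF monom_embedding[OF H(1)]] unfolding cls_def .
    moreover have "set_mset (\<zeta> l) \<subseteq> H" if "l \<in> J" for l
      using facts that unfolding numerical_atoms_def by blast
    ultimately have "inj_on cls (set_mset (\<zeta> i) \<union> set_mset (\<zeta> j))"
      using ij by (meson inj_on_subset le_sup_iff)
    moreover have "image_mset cls (\<zeta> i) = image_mset cls (\<zeta> j) + {#}"
      using ij(3) by (simp add: Z_def)
    ultimately have "\<zeta> i = \<zeta> j"
      using image_mset_eq_image_mset_plusD by fastforce
    then show "i = j"
      using inj ij by (meson inj_onD)
  qed
  have "?g \<in> carrier ?R"
    using H by (simp add: monom_in_semigroup_algebra)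
  moreover have "squarefree_in ?R ?g"
    using H sf by (rule squarefree_monom)
  moreover have "set_of_lengths ?R ?g = L"
    unfolding set_of_lengths_def fac image_image using size_Z J(3) by simp
  moreover have "card (factorizations_of_length ?R k ?g) = f k" if "k \<in> L" for k
  proof -
    have "factorizations_of_length ?R k ?g = Z ` {j \<in> J. fst j = k}"
      unfolding factorizations_of_length_def fac using size_Z by auto
    moreover have "{j \<in> J. fst j = k} = Pair k ` {..<f k}"
      using that by (auto simp: J_def)
    moreover have "inj_on Z {j \<in> J. fst j = k}"
      using inj_Z by (rule inj_on_subset) blast
    ultimately show ?thesis
      by (simp add: card_image inj_on_def)
  qed
  ultimately show ?thesis
    using H(1) by blast
qed
end
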